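(* Let $n$ be a positive integer, $0<\alpha_1,\alpha_2<1$, and let $\underline{W}=(W_1,W_2)$ be a random vector following the negative $\mathcal{R}(p,q)$-trinomial probability distribution of the first kind with parameters $n$, $\underline{\alpha}=(\alpha_1,\alpha_2)$, $p$ and $q$, i.e. with mass function $$P(W_1=w_1,W_2=w_2)=\begin{bmatrix} n+w_1+w_2-1\\ w_1,w_2\end{bmatrix}_{\mathcal{R}(p,q)}\frac{\alpha_1^{w_1}\alpha_2^{w_2}\,\phi_1^{\binom{n-w_1}{2}+\binom{n-w_2}{2}}\,\phi_2^{\binom{w_1}{2}+\binom{w_2}{2}}}{(1\oplus\alpha_1)^{n+w_1+w_2}_{\mathcal{R}(p,q)}\,(1\oplus\alpha_2)^{n+w_2}_{\mathcal{R}(p,q)}},\qquad w_1,w_2\in\mathbb{N}\cup\{0\}.$$ Put $\widehat{W}=\big(\phi_1^{n+W_2}+\alpha_2\,\phi_2^{n+W_2}\big)^{-1}[W_1]_{\mathcal{R}(p^{-1},q^{-1})}$ and $\overline{W}=[W_2]_{\mathcal{R}(p^{-1},q^{-1})}$. Then $$\mathrm{Cov}\big(\widehat{W},\overline{W}\big)=[n]_{\mathcal{R}(p,q)}\,\alpha_1\alpha_2\big([n+1]_{\mathcal{R}(p,q)}-[n]_{\mathcal{R}(p,q)}\big).$$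
   Context: Let $0<q<p<1$ be real numbers and let $\mathcal{R}(u,v)=\sum_{s,t=-l}^{\infty}r_{st}u^sv^t$ ($r_{st}\in\mathbb{C}$, $l\in\mathbb{N}\cup\{0\}$) be a meromorphic function on $\mathbb{C}\times\mathbb{C}$ with $\mathcal{R}(p^n,q^n)>0$ for all $n\in\mathbb{N}$ and $\mathcal{R}(1,1)=0$. The $\mathcal{R}(p,q)$-deformed numbers are $[n]_{\mathcal{R}(p,q)}=\mathcal{R}(p^n,q^n)$, and it is assumed that they can be written as $[n]_{\mathcal{R}(p,q)}=\frac{\phi_1^n-\phi_2^n}{\phi_1-\phi_2}$, where $\phi_1\ne\phi_2$ are functions of the deformation parameters $p,q$. The $\mathcal{R}(p^{-1},q^{-1})$-numbers satisfy $[x]_{\mathcal{R}(p^{-1},q^{-1})}=(\phi_1\phi_2)^{1-x}[x]_{\mathcal{R}(p,q)}$. Factorials: $[0]!_{\mathcal{R}(p,q)}=1$ and $[n]!_{\mathcal{R}(p,q)}=\prod_{i=1}^{n}[i]_{\mathcal{R}(p,q)}$. Trinomial coefficient: $\begin{bmatrix} N\\ a,b\end{bmatrix}_{\mathcal{R}(p,q)}=\frac{[N]!_{\mathcal{R}(p,q)}}{[a]!_{\mathcal{R}(p,q)}[b]!_{\mathcal{R}(p,q)}[N-a-b]!_{\mathcal{R}(p,q)}}$. Shifted factorial: $(u\oplus v)^n_{\mathcal{R}(p,q)}=\prod_{i=1}^{n}(u\phi_1^{i-1}+v\phi_2^{i-1})$, with $(u\oplus v)^0_{\mathcal{R}(p,q)}=1$.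 For integers $k$ (possibly negative), $\binom{k}{2}=k(k-1)/2$. The covariance is $\mathrm{Cov}(A,B)=E(AB)-E(A)E(B)$.
   Formalization: Adds the assumption that the mass function is nonnegative and sums to 1 for all n ≥ 1 and all 0<α1,α2<1, not only at the given parameters; this forces φ1 = 1. Without it the claim is false, e.g. φ1=p=0.8, φ2=1/q=2, n=1, α1=α2≈0.2373. *)

theory Defs
  imports "HOL-Probability.Probability"
begin

section \<open>Meromorphic functions of two complex variables\<close>

definition holomorphic2_on :: "(complex \<times> complex \<Rightarrow> complex) \<Rightarrow> (complex \<times> complex) set \<Rightarrow> bool" where
  "holomorphic2_on f S \<longleftrightarrow>
     (\<forall>z\<in>S. \<exists>a b. (f has_derivative (\<lambda>(h, k). a * h + b * k)) (at z))"

text \<open>Locally a quotient of holomorphic functions whose denominator vanishes on no nonempty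
  open set. The values at the zeros of the denominator are left unconstrained.\<close>

definition meromorphic2 :: "(complex \<times> complex \<Rightarrow> complex) \<Rightarrow> bool" where
  "meromorphic2 f \<longleftrightarrow>
     (\<forall>z. \<exists>U g h. open U \<and> z \<in> U \<and> holomorphic2_on g U \<and> holomorphic2_on h U \<and>
        interior {w \<in> U. h w = 0} = {} \<and> (\<forall>w\<in>U. h w \<noteq> 0 \<longrightarrow> f w = g w / h w))"

text \<open>The expansion \<open>f(u,v) = \<Sum>\<^sub>s\<^sub>,\<^sub>t\<^sub>\<ge>\<^sub>-\<^sub>l r\<^sub>s\<^sub>t u\<^sup>s v\<^sup>t\<close> is only required for small nonzero \<open>u\<close>, \<open>v\<close>.\<close>

definition has_laurent_expansion2 :: "(complex \<times> complex \<Rightarrow> complex) \<Rightarrow> bool" where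
  "has_laurent_expansion2 f \<longleftrightarrow>
     (\<exists>(l::nat) (r :: int \<Rightarrow> int \<Rightarrow> complex) (\<rho>::real). \<rho> > 0 \<and>
        (\<forall>u v. 0 < norm u \<and> norm u < \<rho> \<and> 0 < norm v \<and> norm v < \<rho> \<longrightarrow>
           ((\<lambda>(s, t). r s t * u powi s * v powi t) has_sum f (u, v)) ({- int l..} \<times> {- int l..})))"


section \<open>Deformed numbers\<close>

text \<open>The deformation function depends on the deformation parameters as well, as in
  \<open>(u - v) / (p - q)\<close>; hence \<open>R p q\<close> is the two-variable function. The
  numbers for the inverse parameters are those of \<open>R (1/p) (1/q)\<close>. The deformed numbers are real
  by the assumptions in \<open>deformation\<close> below, so taking the real part loses nothing.\<close>

type_synonym deform = "real \<Rightarrow> real \<Rightarrow> complex \<times> complex \<Rightarrow> complex"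

definition R_number :: "deform \<Rightarrow> real \<Rightarrow> real \<Rightarrow> nat \<Rightarrow> real" where
  "R_number R p q n = Re (R p q (of_real (p ^ n), of_real (q ^ n)))"

text \<open>\<open>\<phi>\<^sub>1\<close> and \<open>\<phi>\<^sub>2\<close> are nonzero because the relation for the inverse parameters involves negative
  powers of their product.\<close>

definition deformation ::
    "deform \<Rightarrow> (real \<Rightarrow> real \<Rightarrow> real) \<Rightarrow> (real \<Rightarrow> real \<Rightarrow> real) \<Rightarrow> real \<Rightarrow> real \<Rightarrow> bool" where
  "deformation R \<phi>1 \<phi>2 p q \<longleftrightarrow>
     meromorphic2 (R p q) \<and> has_laurent_expansion2 (R p q) \<and>
     (\<forall>n\<ge>1. R p q (of_real (p ^ n), of_real (q ^ n)) \<in> \<real> \<and> R_number R p q n > 0) \<and>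
     R p q (1, 1) = 0 \<and>
     \<phi>1 p q \<noteq> \<phi>2 p q \<and> \<phi>1 p q \<noteq> 0 \<and> \<phi>2 p q \<noteq> 0 \<and>
     (\<forall>n. R_number R p q n = (\<phi>1 p q ^ n - \<phi>2 p q ^ n) / (\<phi>1 p q - \<phi>2 p q)) \<and>
     (\<forall>n. R (1 / p) (1 / q) (of_real ((1 / p) ^ n), of_real ((1 / q) ^ n)) =
            of_real ((\<phi>1 p q * \<phi>2 p q) powi (1 - int n) * R_number R p q n))"

definition R_fact :: "(nat \<Rightarrow> real) \<Rightarrow> nat \<Rightarrow> real" where
  "R_fact num n = (\<Prod>i=1..n. num i)"

definition R_trinomial :: "(nat \<Rightarrow> real) \<Rightarrow> nat \<Rightarrow> nat \<Rightarrow> nat \<Rightarrow> real" where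
  "R_trinomial num N a b = R_fact num N / (R_fact num a * R_fact num b * R_fact num (N - a - b))"

definition shifted_fact :: "real \<Rightarrow> real \<Rightarrow> real \<Rightarrow> real \<Rightarrow> nat \<Rightarrow> real" where
  "shifted_fact f1 f2 u v n = (\<Prod>i=1..n. u * f1 ^ (i - 1) + v * f2 ^ (i - 1))"

definition binom2 :: "int \<Rightarrow> int" where
  "binom2 k = k * (k - 1) div 2"


section \<open>The negative trinomial distribution of the first kind\<close>

definition neg_trinomial_mass ::
    "(nat \<Rightarrow> real) \<Rightarrow> real \<Rightarrow> real \<Rightarrow> nat \<Rightarrow> real \<Rightarrow> real \<Rightarrow> nat \<Rightarrow> nat \<Rightarrow> real" where
  "neg_trinomial_mass num f1 f2 n \<alpha>1 \<alpha>2 w1 w2 =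
     R_trinomial num (n + w1 + w2 - 1) w1 w2 *
     (\<alpha>1 ^ w1 * \<alpha>2 ^ w2 *
      f1 powi (binom2 (int n - int w1) + binom2 (int n - int w2)) *
      f2 powi (binom2 (int w1) + binom2 (int w2))) /
     (shifted_fact f1 f2 1 \<alpha>1 (n + w1 + w2) * shifted_fact f1 f2 1 \<alpha>2 (n + w2))"

text \<open>The negative trinomial law is a family of probability distributions indexed by
  \<open>n \<ge> 1\<close> and \<open>0 < \<alpha>\<^sub>1, \<alpha>\<^sub>2 < 1\<close>. That the mass functions of the family are normalised is a genuine
  condition on \<open>\<phi>\<^sub>1\<close>, \<open>\<phi>\<^sub>2\<close>. Normalisation at one isolated parameter value is not enough for the
  moment formulas: for \<open>\<phi>\<^sub>1 = p = 0.8\<close>, \<open>\<phi>\<^sub>2 = 1/q = 2\<close>, \<open>n = 1\<close> the total mass is 1 at some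
  \<open>\<alpha>\<^sub>1 = \<alpha>\<^sub>2\<close> close to 0.2373, but not at other values.\<close>

definition neg_trinomial_family :: "(nat \<Rightarrow> real) \<Rightarrow> real \<Rightarrow> real \<Rightarrow> bool" where
  "neg_trinomial_family num f1 f2 \<longleftrightarrow>
     (\<forall>n\<ge>1. \<forall>\<alpha>1\<in>{0<..<1}. \<forall>\<alpha>2\<in>{0<..<1}.
        (\<forall>w1 w2. neg_trinomial_mass num f1 f2 n \<alpha>1 \<alpha>2 w1 w2 \<ge> 0) \<and>
        ((\<lambda>(w1, w2). neg_trinomial_mass num f1 f2 n \<alpha>1 \<alpha>2 w1 w2) has_sum 1) UNIV)"

definition neg_trinomial_distributed ::
    "'a measure \<Rightarrow> ('a \<Rightarrow> nat) \<Rightarrow> ('a \<Rightarrow> nat) \<Rightarrow> (nat \<Rightarrow> real) \<Rightarrow> real \<Rightarrow> real \<Rightarrow> nat \<Rightarrow> real \<Rightarrow> real \<Rightarrow> bool" where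
  "neg_trinomial_distributed M W1 W2 num f1 f2 n \<alpha>1 \<alpha>2 \<longleftrightarrow>
     prob_space M \<and> W1 \<in> measurable M (count_space UNIV) \<and> W2 \<in> measurable M (count_space UNIV) \<and>
     (\<forall>w1 w2. measure M {\<omega> \<in> space M. W1 \<omega> = w1 \<and> W2 \<omega> = w2} =
        neg_trinomial_mass num f1 f2 n \<alpha>1 \<alpha>2 w1 w2)"

definition covariance :: "'a measure \<Rightarrow> ('a \<Rightarrow> real) \<Rightarrow> ('a \<Rightarrow> real) \<Rightarrow> real" where
  "covariance M A B =
     integral\<^sup>L M (\<lambda>\<omega>. A \<omega> * B \<omega>) - integral\<^sup>L M A * integral\<^sup>L M B"

definition W_hat ::
    "deform \<Rightarrow> (real \<Rightarrow> real \<Rightarrow> real) \<Rightarrow> (real \<Rightarrow> real \<Rightarrow> real) \<Rightarrow> real \<Rightarrow> real \<Rightarrow> nat \<Rightarrow> real \<Rightarrow>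
     ('a \<Rightarrow> nat) \<Rightarrow> ('a \<Rightarrow> nat) \<Rightarrow> 'a \<Rightarrow> real" where
  "W_hat R \<phi>1 \<phi>2 p q n \<alpha>2 W1 W2 \<omega> =
     inverse (\<phi>1 p q ^ (n + W2 \<omega>) + \<alpha>2 * \<phi>2 p q ^ (n + W2 \<omega>)) * R_number R (1 / p) (1 / q) (W1 \<omega>)"

definition W_bar :: "deform \<Rightarrow> real \<Rightarrow> real \<Rightarrow> ('a \<Rightarrow> nat) \<Rightarrow> 'a \<Rightarrow> real" where
  "W_bar R p q W2 \<omega> = R_number R (1 / p) (1 / q) (W2 \<omega>)"

end

theory Submission
  imports Defs
begin

text \<open>
  Write \<open>a\<close>, \<open>b\<close> for the values of \<open>\<phi>\<^sub>1\<close>, \<open>\<phi>\<^sub>2\<close> and \<open>[k]\<close> for the deformed numbers. The covariance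
  formula is a consequence of an absorption property of the mass function \<open>f\<^sub>n(w\<^sub>1, w\<^sub>2)\<close>. If
  \<open>a = 1\<close>, the weight \<open>b\<^bsup>1-w\<^esup> [w]\<close> of the numbers for the inverse parameters removes exactly what
  distinguishes \<open>f\<^sub>n\<close> from \<open>f\<^sub>n\<^sub>+\<^sub>1\<close> at a shifted argument (\<open>mass_absorb1\<close>, \<open>mass_absorb2\<close>):
  weighting by the first variable gives \<open>[n] \<alpha>\<^sub>1 f\<^sub>n\<^sub>+\<^sub>1(w\<^sub>1 - 1, w\<^sub>2)\<close>, where the random factor in front
  of \<open>[W\<^sub>1]\<close> lengthens the second shifted factorial by the one factor that it lacks, and weighting by
  the second variable gives \<open>[n] \<alpha>\<^sub>2 f\<^sub>n\<^sub>+\<^sub>1(w\<^sub>1, w\<^sub>2 - 1)\<close>. Since \<open>f\<^sub>n\<^sub>+\<^sub>1\<close> and \<open>f\<^sub>n\<^sub>+\<^sub>2\<close> are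
  normalised, the two means are \<open>[n] \<alpha>\<^sub>1\<close> and \<open>[n] \<alpha>\<^sub>2\<close>, and doing both steps in turn gives the mixed
  moment \<open>[n] [n + 1] \<alpha>\<^sub>1 \<alpha>\<^sub>2\<close>.

  For \<open>a \<noteq> 1\<close> the absorption leaves behind a power of \<open>a\<close> that depends on \<open>w\<^sub>1\<close> and \<open>w\<^sub>2\<close>. So the
  substance of the proof is that normalisation of the whole family forces \<open>a = 1\<close>
  (\<open>neg_trinomial_family_imp_f1_eq_1\<close>), and \<open>n = 1\<close> is already enough. Formally, the coefficient
  of \<open>\<alpha>\<^sub>1\<close> in the total mass is \<open>1 / a - 1\<close>, with the contribution \<open>-1\<close> from the point \<open>(0,0)\<close> and
  \<open>1 / a\<close> from \<open>(1,0)\<close>, and it has to vanish. One half of this needs no convergence: the two masses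
  together are at most \<open>1\<close>, which gives \<open>a \<ge> 1\<close>. For the other half the masses of all remaining
  points must be \<open>O(\<alpha>\<^sup>2)\<close> on the diagonal \<open>\<alpha>\<^sub>1 = \<alpha>\<^sub>2 = \<alpha>\<close>. This is clear when \<open>0 < b < a\<close>, because
  then the masses at \<open>\<alpha>\<close> are controlled by those at \<open>\<alpha> = 1/2\<close>
  (\<open>neg_trinomial_family_mass_comparison\<close>). For \<open>a > 1\<close> the other values of \<open>b\<close> are excluded directly: a
  negative \<open>b\<close> makes the mass at \<open>(2,0)\<close> negative, and if both \<open>a\<close> and \<open>b\<close> exceed \<open>1\<close>, the masses on
  the axis \<open>w\<^sub>2 = 0\<close> are unbounded.
\<close>

section \<open>Factorials, trinomial coefficients and shifted factorials\<close>

lemma binom2_Suc: "binom2 (int (Suc w)) = binom2 (int w) + int w"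
proof -
  have "int (Suc w) * (int (Suc w) - 1) = int w * (int w - 1) + 2 * int w"
    by (simp add: algebra_simps)
  then show ?thesis
    by (simp add: binom2_def)
qed

lemma binom2_0 [simp]: "binom2 0 = 0" and binom2_1 [simp]: "binom2 1 = 0"
  by (simp_all add: binom2_def)

lemma binom2_one_minus: "binom2 (1 - k) = binom2 k"
  by (simp add: binom2_def algebra_simps)

lemma R_fact_0 [simp]: "R_fact num 0 = 1"
  by (simp add: R_fact_def)

lemma R_fact_Suc: "R_fact num (Suc n) = num (Suc n) * R_fact num n"
  by (simp add: R_fact_def mult.commute)

lemma R_fact_pos:
  assumes "\<forall>k\<ge>1. num k > 0"
  shows "R_fact num n > 0"
  unfolding R_fact_def by (intro prod_pos) (use assms in auto)

lemma R_trinomial_pos: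
  assumes "\<forall>k\<ge>1. num k > 0"
  shows "R_trinomial num N a b > 0"
  unfolding R_trinomial_def using R_fact_pos[of num, OF assms] by simp

lemma R_trinomial_commute: "R_trinomial num N a b = R_trinomial num N b a"
  by (simp add: R_trinomial_def mult.commute add.commute)

lemma R_trinomial_self:
  assumes "\<forall>k\<ge>1. num k > 0"
  shows "R_trinomial num w w 0 = 1"
  unfolding R_trinomial_def using R_fact_pos[of num w, OF assms] by simp

text \<open>This is the deformed version of \<open>k (N choose k) = (N - k + 1) (N choose (k - 1))\<close>: the
  factor lowers the first entry and passes one unit to the third, implicit entry, which grows from
  \<open>n - 1\<close> to \<open>n\<close>. The right-hand coefficient is therefore the one in the mass function for \<open>n + 1\<close>.\<close>

lemma R_trinomial_absorb:
  assumes num: "\<forall>k\<ge>1. num k > 0" and "n \<ge> 1"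
  shows "num (Suc a) * R_trinomial num (n + a + b) (Suc a) b =
         num n * R_trinomial num (n + a + b) a b"
proof -
  obtain m where n: "n = Suc m"
    using \<open>n \<ge> 1\<close> by (cases n) auto
  have pos: "R_fact num k > 0" for k
    using R_fact_pos[of num, OF num] .
  have "num (Suc a) > 0" "num (Suc m) > 0"
    using num by auto
  moreover have "n + a + b - Suc a - b = m" "n + a + b - a - b = Suc m"
    by (simp_all add: n)
  ultimately show ?thesis
    using pos[of a] pos[of b] pos[of m]
    by (simp add: R_trinomial_def R_fact_Suc n field_simps)
qed

lemma shifted_fact_0 [simp]: "shifted_fact f1 f2 u v 0 = 1"
  by (simp add: shifted_fact_def)

lemma shifted_fact_Suc:
  "shifted_fact f1 f2 u v (Suc n) = shifted_fact f1 f2 u v n * (u * f1 ^ n + v * f2 ^ n)"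
  by (simp add: shifted_fact_def)

lemma shifted_fact_pos:
  assumes "f1 > 0" "f2 > 0" "u > 0" "v > 0"
  shows "shifted_fact f1 f2 u v n > 0"
  unfolding shifted_fact_def by (intro prod_pos) (use assms in \<open>auto intro!: add_pos_pos\<close>)

text \<open>After division by the powers of \<open>f1\<close> the left-hand side is a partial product of
  \<open>\<Prod>\<^sub>j (1 + \<beta> Q\<^sup>j)\<close> with \<open>Q = f2 / f1 < 1\<close>, which converges. Hence the constant does not depend
  on \<open>n\<close>, and for \<open>f2 < f1\<close> changing \<open>\<alpha>\<close> costs only a bounded factor in the denominators of the
  masses.\<close>

lemma shifted_fact_ratio_bound:
  assumes "0 < f2" "f2 < f1" "0 \<le> \<alpha>" "0 \<le> \<beta>"
  shows "shifted_fact f1 f2 1 \<beta> n \<le> exp (\<beta> / (1 - f2 / f1)) * shifted_fact f1 f2 1 \<alpha> n"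
proof -
  define Q where "Q = f2 / f1"
  have Q: "0 < Q" "Q < 1"
    using assms by (auto simp: Q_def)
  have step: "1 * f1 ^ j + \<beta> * f2 ^ j \<le> (1 * f1 ^ j + \<alpha> * f2 ^ j) * exp (\<beta> * Q ^ j)" for j
  proof -
    have "f1 ^ j + \<beta> * f2 ^ j = f1 ^ j * (1 + \<beta> * Q ^ j)"
      using assms by (simp add: Q_def field_simps)
    also have "\<dots> \<le> (f1 ^ j + \<alpha> * f2 ^ j) * exp (\<beta> * Q ^ j)"
      by (intro mult_mono exp_ge_add_one_self) (use assms Q in auto)
    finally show ?thesis by simp
  qed
  have "(\<Sum>j<n. Q ^ j) \<le> 1 / (1 - Q)"
    using sum_le_suminf[of "\<lambda>j. Q ^ j" "{..<n}"] Q by (simp add: suminf_geometric)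
  then have sum: "(\<Sum>j<n. \<beta> * Q ^ j) \<le> \<beta> / (1 - Q)"
    using mult_left_mono[of _ _ \<beta>] assms by (fastforce simp: sum_distrib_left)
  have sf: "shifted_fact f1 f2 1 v n = (\<Prod>j<n. 1 * f1 ^ j + v * f2 ^ j)" for v
    by (induction n) (simp_all add: shifted_fact_Suc)
  have nonneg: "0 \<le> shifted_fact f1 f2 1 \<alpha> n"
    unfolding sf by (intro prod_nonneg) (use assms in auto)
  have "shifted_fact f1 f2 1 \<beta> n \<le> (\<Prod>j<n. (1 * f1 ^ j + \<alpha> * f2 ^ j) * exp (\<beta> * Q ^ j))"
    unfolding sf by (intro prod_mono conjI step) (use assms in auto)
  also have "\<dots> = shifted_fact f1 f2 1 \<alpha> n * exp (\<Sum>j<n. \<beta> * Q ^ j)"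
    by (simp add: sf prod.distrib exp_sum)
  also have "\<dots> \<le> shifted_fact f1 f2 1 \<alpha> n * exp (\<beta> / (1 - Q))"
    using sum nonneg by (intro mult_left_mono) auto
  finally show ?thesis
    by (simp add: Q_def mult.commute)
qed

section \<open>Normalisation forces the first deformation parameter to be one\<close>

lemma mass_one_axis1:
  assumes "\<forall>k\<ge>1. num k > 0"
  shows "neg_trinomial_mass num f1 f2 1 \<alpha>1 \<alpha>2 w 0 =
    \<alpha>1 ^ w * f1 powi binom2 (int w) * f2 powi binom2 (int w) /
    (shifted_fact f1 f2 1 \<alpha>1 (Suc w) * (1 + \<alpha>2))"
  using R_trinomial_self[of num w, OF assms]
  by (simp add: neg_trinomial_mass_def binom2_one_minus shifted_fact_Suc)

lemma neg_trinomial_familyD: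
  assumes "neg_trinomial_family num f1 f2" "n \<ge> 1" "0 < \<alpha>1" "\<alpha>1 < 1" "0 < \<alpha>2" "\<alpha>2 < 1"
  shows "neg_trinomial_mass num f1 f2 n \<alpha>1 \<alpha>2 w1 w2 \<ge> 0"
    and "((\<lambda>(w1, w2). neg_trinomial_mass num f1 f2 n \<alpha>1 \<alpha>2 w1 w2) has_sum 1) UNIV"
  using assms unfolding neg_trinomial_family_def by auto

lemma neg_trinomial_family_sum_le_1:
  assumes "neg_trinomial_family num f1 f2" "n \<ge> 1" "0 < \<alpha>1" "\<alpha>1 < 1" "0 < \<alpha>2" "\<alpha>2 < 1"
    and "finite F"
  shows "(\<Sum>(w1, w2)\<in>F. neg_trinomial_mass num f1 f2 n \<alpha>1 \<alpha>2 w1 w2) \<le> 1"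
  using neg_trinomial_familyD[OF assms(1-6)] assms(7)
  by (intro finite_sum_le_has_sum) auto

text \<open>With \<open>n = 1\<close> and \<open>c = f1 + \<alpha> f2\<close>, the masses at \<open>(0,0)\<close> and \<open>(1,0)\<close> add up to
  \<open>(1 + \<alpha> / c) / ((1 + \<alpha>) (1 + \<beta>))\<close>. Here \<open>c\<close> cannot be
  negative, since the mass at \<open>(1,0)\<close> is not. If \<open>0 < c < 1\<close>, the sum exceeds \<open>1\<close> for small \<open>\<beta>\<close>; and \<open>c\<close> tends to
  \<open>f1\<close> as \<open>\<alpha>\<close> tends to \<open>0\<close>.\<close>

lemma neg_trinomial_family_f1_ge_1:
  assumes num: "\<forall>k\<ge>1. num k > 0" and fam: "neg_trinomial_family num f1 f2"
    and "f1 \<noteq> 0"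
  shows "f1 \<ge> 1"
proof (rule ccontr)
  assume "\<not> f1 \<ge> 1"
  have lim: "((\<lambda>\<alpha>. f1 + \<alpha> * f2) \<longlongrightarrow> f1) (at_right 0)"
    by (auto intro!: tendsto_eq_intros)
  \<comment> \<open>\<open>f1 + \<alpha> * f2\<close> divides the mass at \<open>(1,0)\<close>; if it were \<open>0\<close>, that mass would be \<open>0\<close> by
    convention and carry no information.\<close>
  have "eventually (\<lambda>\<alpha>. f1 + \<alpha> * f2 < 1) (at_right 0)"
    using \<open>\<not> f1 \<ge> 1\<close> by (intro order_tendstoD[OF lim]) auto
  moreover have "eventually (\<lambda>\<alpha>. f1 + \<alpha> * f2 \<noteq> 0) (at_right 0)"
    using tendsto_imp_eventually_ne[OF lim \<open>f1 \<noteq> 0\<close>] .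
  moreover have "eventually (\<lambda>\<alpha>::real. \<alpha> \<in> {0<..<1}) (at_right 0)"
    by (rule eventually_at_right_real) simp
  ultimately have "eventually (\<lambda>\<alpha>. f1 + \<alpha> * f2 < 1 \<and> f1 + \<alpha> * f2 \<noteq> 0 \<and> 0 < \<alpha> \<and> \<alpha> < 1) (at_right 0)"
    by eventually_elim auto
  then obtain \<alpha> where \<alpha>: "f1 + \<alpha> * f2 < 1" "f1 + \<alpha> * f2 \<noteq> 0" "0 < \<alpha>" "\<alpha> < 1"
    by (auto dest: eventually_happens'[OF trivial_limit_at_right_real])
  define c where "c = f1 + \<alpha> * f2"
  have mass0: "neg_trinomial_mass num f1 f2 1 \<alpha> \<beta> 0 0 = 1 / ((1 + \<alpha>) * (1 + \<beta>))" for \<beta>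
    unfolding mass_one_axis1[OF num] by (simp add: shifted_fact_Suc)
  have mass1: "neg_trinomial_mass num f1 f2 1 \<alpha> \<beta> 1 0 = \<alpha> / ((1 + \<alpha>) * c * (1 + \<beta>))" for \<beta>
    unfolding mass_one_axis1[OF num] by (simp add: shifted_fact_Suc c_def)
  have "\<alpha> / ((1 + \<alpha>) * c * (1 + 1 / 2)) \<ge> 0"
    using neg_trinomial_familyD(1)[OF fam, of 1 \<alpha> "1/2" 1 0] \<alpha> unfolding mass1 by simp
  then have "c > 0"
    using \<alpha> unfolding c_def[symmetric] by (simp add: zero_le_divide_iff zero_le_mult_iff)
  have le: "1 + \<alpha> / c \<le> (1 + \<alpha>) * (1 + \<beta>)" if "0 < \<beta>" "\<beta> < 1" for \<beta>
  proof -
    have "1 / ((1 + \<alpha>) * (1 + \<beta>)) + \<alpha> / ((1 + \<alpha>) * c * (1 + \<beta>)) \<le> 1"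
      using neg_trinomial_family_sum_le_1[OF fam, of 1 \<alpha> \<beta> "{(0,0),(1,0)}"] \<alpha> that
      by (simp add: mass0[simplified] mass1[simplified])
    moreover have "1 / ((1 + \<alpha>) * (1 + \<beta>)) + \<alpha> / ((1 + \<alpha>) * c * (1 + \<beta>)) =
        (1 + \<alpha> / c) / ((1 + \<alpha>) * (1 + \<beta>))"
      using \<open>c > 0\<close> \<alpha> that by (simp add: divide_simps)
    ultimately show ?thesis
      using \<alpha> that by (simp add: divide_le_eq)
  qed
  have "((\<lambda>\<beta>. (1 + \<alpha>) * (1 + \<beta>)) \<longlongrightarrow> 1 + \<alpha>) (at_right 0)"
    by (auto intro!: tendsto_eq_intros)
  moreover have "eventually (\<lambda>\<beta>::real. \<beta> \<in> {0<..<1}) (at_right 0)"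
    by (rule eventually_at_right_real) simp
  then have "eventually (\<lambda>\<beta>. 1 + \<alpha> / c \<le> (1 + \<alpha>) * (1 + \<beta>)) (at_right 0)"
    by eventually_elim (use le in auto)
  ultimately have "1 + \<alpha> / c \<le> 1 + \<alpha>"
    by (rule tendsto_lowerbound) simp
  then have "c \<ge> 1"
    using \<open>c > 0\<close> \<alpha> by (simp add: field_simps)
  then show False
    using \<alpha> by (simp add: c_def)
qed

text \<open>For \<open>n = 1\<close>, \<open>(2,0)\<close> is the first point of the axis \<open>w\<^sub>2 = 0\<close> whose mass contains a power of
  \<open>f2\<close> in the numerator, namely \<open>f2\<close> itself.
  For small \<open>\<alpha>\<close> the denominator is positive, so the sign of that mass is the sign of \<open>f2\<close>.\<close>

lemma neg_trinomial_family_f2_pos: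
  assumes num: "\<forall>k\<ge>1. num k > 0" and fam: "neg_trinomial_family num f1 f2"
    and "f1 > 0" "f2 \<noteq> 0"
  shows "f2 > 0"
proof (rule ccontr)
  assume "\<not> f2 > 0"
  with \<open>f2 \<noteq> 0\<close> have "f2 < 0" by simp
  have lim: "((\<lambda>\<alpha>. f1 + \<alpha> * f2) \<longlongrightarrow> f1) (at_right 0)"
    by (auto intro!: tendsto_eq_intros)
  have "eventually (\<lambda>\<alpha>. f1 + \<alpha> * f2 > 0) (at_right 0)"
    using \<open>f1 > 0\<close> by (intro order_tendstoD[OF lim])
  moreover have "eventually (\<lambda>\<alpha>::real. \<alpha> \<in> {0<..<1}) (at_right 0)"
    by (rule eventually_at_right_real) simp
  ultimately have "eventually (\<lambda>\<alpha>. f1 + \<alpha> * f2 > 0 \<and> 0 < \<alpha> \<and> \<alpha> < 1) (at_right 0)"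
    by eventually_elim auto
  then obtain \<alpha> where \<alpha>: "f1 + \<alpha> * f2 > 0" "0 < \<alpha>" "\<alpha> < 1"
    by (auto dest: eventually_happens'[OF trivial_limit_at_right_real])
  have binom: "binom2 (int 2) = 1"
    by (simp add: binom2_def)
  have sf: "shifted_fact f1 f2 1 \<alpha> (Suc 2) =
      (1 + \<alpha>) * (f1 + \<alpha> * f2) * (f1\<^sup>2 + \<alpha> * f2\<^sup>2)"
    by (simp add: shifted_fact_Suc power2_eq_square numeral_2_eq_2)
  have "neg_trinomial_mass num f1 f2 1 \<alpha> (1/2) 2 0 =
      \<alpha>\<^sup>2 * f1 * f2 / (((1 + \<alpha>) * (f1 + \<alpha> * f2) * (f1\<^sup>2 + \<alpha> * f2\<^sup>2)) * (1 + 1/2))"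
    unfolding mass_one_axis1[OF num] sf binom by simp
  moreover have "\<alpha>\<^sup>2 * f1 * f2 < 0"
    using \<alpha> \<open>f1 > 0\<close> \<open>f2 < 0\<close> by (intro mult_pos_neg mult_pos_pos) auto
  moreover have "f1\<^sup>2 + \<alpha> * f2\<^sup>2 > 0"
    using \<alpha> \<open>f1 > 0\<close> by (intro add_pos_nonneg) auto
  then have "(1 + \<alpha>) * (f1 + \<alpha> * f2) * (f1\<^sup>2 + \<alpha> * f2\<^sup>2) * (1 + 1/2) > 0"
    using \<alpha> by (intro mult_pos_pos) auto
  ultimately have "neg_trinomial_mass num f1 f2 1 \<alpha> (1/2) 2 0 < 0"
    by (simp only: divide_neg_pos)
  then show False
    using neg_trinomial_familyD(1)[OF fam, of 1 \<alpha> "1/2" 2 0] \<alpha> by simp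
qed

text \<open>For \<open>n = 1\<close> consecutive masses on the axis \<open>w\<^sub>2 = 0\<close> have the ratio
  \<open>\<alpha> (f1 f2)\<^sup>w / (f1\<^bsup>w+1\<^esup> + \<alpha> f2\<^bsup>w+1\<^esup>)\<close>. When both parameters exceed \<open>1\<close>, it tends to infinity,
  whichever of the two is larger, while masses are at most \<open>1\<close>.\<close>

lemma neg_trinomial_family_f2_le_1:
  assumes num: "\<forall>k\<ge>1. num k > 0" and fam: "neg_trinomial_family num f1 f2"
    and "f1 > 1" "f2 > 0"
  shows "f2 \<le> 1"
proof (rule ccontr)
  assume "\<not> f2 \<le> 1"
  then have "f2 > 1" by simp
  define m where "m = (\<lambda>w. neg_trinomial_mass num f1 f2 1 (1/2) (1/2) w 0)"
  have sf: "shifted_fact f1 f2 1 (1/2) w > 0" for w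
    using shifted_fact_pos assms by simp
  have m_pos: "m w > 0" for w
    unfolding m_def mass_one_axis1[OF num] using sf assms by (simp del: of_nat_Suc)
  have m_le: "m w \<le> 1" for w
    using neg_trinomial_family_sum_le_1[OF fam, of 1 "1/2" "1/2" "{(w,0)}"] by (simp add: m_def)
  define d where "d = (\<lambda>w. f1 ^ Suc w + 1/2 * f2 ^ Suc w)"
  have d_pos: "d w > 0" for w
    unfolding d_def using assms by (intro add_pos_pos) auto
  have ratio: "m (Suc w) = m w * (1/2 * (f1 * f2) ^ w / d w)" for w
  proof -
    have "shifted_fact f1 f2 1 (1/2) (Suc (Suc w)) = shifted_fact f1 f2 1 (1/2) (Suc w) * d w"
      unfolding shifted_fact_Suc[of f1 f2 1 "1/2" "Suc w"] d_def by simp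
    moreover have "x powi binom2 (int (Suc w)) = x powi binom2 (int w) * x ^ w" if "x > 0" for x :: real
      unfolding binom2_Suc using that by (simp add: power_int_add)
    ultimately show ?thesis
      unfolding m_def mass_one_axis1[OF num] using sf[of "Suc w"] d_pos[of w] assms
      by (simp add: field_simps del: of_nat_Suc)
  qed
  have "((\<lambda>w. f1 * (1 / f2) ^ w + 1/2 * f2 * (1 / f1) ^ w) \<longlonglongrightarrow> 0)"
    using \<open>f1 > 1\<close> \<open>f2 > 1\<close>
    by (intro tendsto_eq_intros LIMSEQ_power_zero tendsto_mult_right_zero) auto
  then have "eventually (\<lambda>w. f1 * (1 / f2) ^ w + 1/2 * f2 * (1 / f1) ^ w < 1/4) sequentially"
    by (rule order_tendstoD) simp
  then obtain w0 where w0: "f1 * (1 / f2) ^ w + 1/2 * f2 * (1 / f1) ^ w < 1/4" if "w \<ge> w0" for w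
    by (auto simp: eventually_sequentially)
  have double: "m (Suc w) \<ge> 2 * m w" if "w \<ge> w0" for w
  proof -
    have "d w = (f1 * (1 / f2) ^ w + 1/2 * f2 * (1 / f1) ^ w) * (f1 * f2) ^ w"
      using assms by (simp add: d_def field_simps)
    also have "\<dots> \<le> 1/4 * (f1 * f2) ^ w"
      using w0[OF that] assms by (intro mult_right_mono) auto
    finally have "2 \<le> 1/2 * (f1 * f2) ^ w / d w"
      using d_pos[of w] by (simp add: field_simps)
    then have "m w * 2 \<le> m w * (1/2 * (f1 * f2) ^ w / d w)"
      using m_pos[of w] by (intro mult_left_mono) auto
    then show ?thesis
      unfolding ratio by (simp only: mult.commute)
  qed
  have "2 ^ k * m w0 \<le> m (w0 + k)" for k
  proof (induction k)
    case (Suc k)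
    then show ?case using double[of "w0 + k"] by simp
  qed simp
  then have "2 ^ k \<le> 1 / m w0" for k
    using order_trans[OF _ m_le[of "w0 + k"]] m_pos[of w0] by (simp add: le_divide_eq)
  moreover obtain k where "1 / m w0 < 2 ^ k"
    using real_arch_pow[of 2 "1 / m w0"] by auto
  ultimately show False
    by (meson not_le)
qed

text \<open>The masses at \<open>\<alpha>\<close> and at \<open>\<beta>\<close> differ only in the power \<open>\<alpha>\<^bsup>w1+w2\<^esup>\<close> and in the two
  shifted factorials of the denominator. The former supplies the factor \<open>(\<alpha> / \<beta>)\<^sup>2\<close> and the latter
  lose a bounded factor each. So all masses off the three smallest points are of second order in \<open>\<alpha>\<close>,
  with a bound that can be summed by means of the normalisation at \<open>\<beta>\<close>.\<close>

lemma neg_trinomial_family_mass_comparison: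
  assumes num: "\<forall>k\<ge>1. num k > 0"
    and f: "0 < f2" "f2 < f1" and "0 < \<alpha>" "\<alpha> \<le> \<beta>" and "w1 + w2 \<ge> 2"
  shows "neg_trinomial_mass num f1 f2 n \<alpha> \<alpha> w1 w2 \<le>
    ((exp (\<beta> / (1 - f2 / f1)))\<^sup>2 * (\<alpha> / \<beta>)\<^sup>2) * neg_trinomial_mass num f1 f2 n \<beta> \<beta> w1 w2"
proof -
  define E where "E = exp (\<beta> / (1 - f2 / f1))"
  define S where "S = shifted_fact f1 f2 1"
  define c where "c = R_trinomial num (n + w1 + w2 - 1) w1 w2 *
      (f1 powi (binom2 (int n - int w1) + binom2 (int n - int w2)) *
       f2 powi (binom2 (int w1) + binom2 (int w2)))"
  have c: "c > 0"
    unfolding c_def using R_trinomial_pos[of num, OF num] f by simp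
  have mass: "neg_trinomial_mass num f1 f2 n a a w1 w2 =
      c * a ^ (w1 + w2) / (S a (n + w1 + w2) * S a (n + w2))" for a
    by (simp add: neg_trinomial_mass_def c_def S_def power_add)
  have S_pos: "S a k > 0" if "a > 0" for a k
    unfolding S_def using shifted_fact_pos f that by simp
  have S_le: "S \<beta> k \<le> E * S \<alpha> k" for k
    unfolding S_def E_def using shifted_fact_ratio_bound f assms by simp
  have E: "E > 0" by (simp add: E_def)
  have "\<alpha> ^ (w1 + w2) = (\<alpha> / \<beta>) ^ (w1 + w2) * \<beta> ^ (w1 + w2)"
    using assms by (simp add: power_divide)
  also have "\<dots> \<le> (\<alpha> / \<beta>)\<^sup>2 * \<beta> ^ (w1 + w2)"
    using assms by (intro mult_right_mono power_decreasing) auto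
  finally have pow: "\<alpha> ^ (w1 + w2) \<le> (\<alpha> / \<beta>)\<^sup>2 * \<beta> ^ (w1 + w2)" .
  have "S \<beta> (n + w1 + w2) * S \<beta> (n + w2) \<le> (E * S \<alpha> (n + w1 + w2)) * (E * S \<alpha> (n + w2))"
    using S_le S_pos assms E by (intro mult_mono) (auto simp: less_imp_le)
  then have den: "S \<beta> (n + w1 + w2) * S \<beta> (n + w2) \<le> E\<^sup>2 * (S \<alpha> (n + w1 + w2) * S \<alpha> (n + w2))"
    by (simp add: power2_eq_square mult_ac)
  have pos: "S \<beta> (n + w1 + w2) * S \<beta> (n + w2) > 0" "S \<alpha> (n + w1 + w2) * S \<alpha> (n + w2) > 0"
    using S_pos assms by auto
  have "1 / (S \<alpha> (n + w1 + w2) * S \<alpha> (n + w2)) \<le> E\<^sup>2 / (S \<beta> (n + w1 + w2) * S \<beta> (n + w2))"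
    using den pos by (simp add: divide_simps mult.commute)
  then have "c * \<alpha> ^ (w1 + w2) * (1 / (S \<alpha> (n + w1 + w2) * S \<alpha> (n + w2))) \<le>
      c * ((\<alpha> / \<beta>)\<^sup>2 * \<beta> ^ (w1 + w2)) * (E\<^sup>2 / (S \<beta> (n + w1 + w2) * S \<beta> (n + w2)))"
    using c pow pos assms by (intro mult_mono) (auto simp: less_imp_le)
  then show ?thesis
    unfolding mass E_def[symmetric] by (simp add: field_simps)
qed

text \<open>On the diagonal and for \<open>n = 1\<close>, the points \<open>(0,0)\<close>, \<open>(1,0)\<close>, \<open>(0,1)\<close> carry the mass
  \<open>(1 + \<alpha> / c + \<alpha> / c\<^sup>2) / (1 + \<alpha>)\<^sup>2\<close> with \<open>c = f1 + \<alpha> f2\<close>, and everything else is \<open>O(\<alpha>\<^sup>2)\<close>. As the total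
  is \<open>1\<close>, this yields \<open>2 \<alpha> \<le> 2 \<alpha> / f1 + O(\<alpha>\<^sup>2)\<close>; division by \<open>\<alpha>\<close> and \<open>\<alpha> \<rightarrow> 0\<close> leave
  \<open>1 \<le> 1 / f1\<close>.\<close>

lemma neg_trinomial_family_f1_le_1:
  assumes num: "\<forall>k\<ge>1. num k > 0" and fam: "neg_trinomial_family num f1 f2"
    and f: "0 < f2" "f2 < f1" "f1 \<ge> 1"
  shows "f1 \<le> 1"
proof -
  define m where "m = (\<lambda>\<alpha> (w1, w2). neg_trinomial_mass num f1 f2 1 \<alpha> \<alpha> w1 w2)"
  \<comment> \<open>The constant of the comparison with \<open>\<beta> = 1/2\<close>, where \<open>(\<alpha> / \<beta>)\<^sup>2 = 4 \<alpha>\<^sup>2\<close>.\<close>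
  define K where "K = (exp ((1/2) / (1 - f2 / f1)))\<^sup>2 * 4"
  define F :: "(nat \<times> nat) set" where "F = {(0,0), (1,0), (0,1)}"
  have total: "(m \<alpha> has_sum 1) UNIV" if "0 < \<alpha>" "\<alpha> < 1" for \<alpha>
    unfolding m_def using neg_trinomial_familyD(2)[OF fam, of 1 \<alpha> \<alpha>] that by simp
  have nonneg: "m \<alpha> x \<ge> 0" if "0 < \<alpha>" "\<alpha> < 1" for \<alpha> x
    unfolding m_def using neg_trinomial_familyD(1)[OF fam, of 1 \<alpha> \<alpha>] that by (cases x) simp
  have rest: "(m \<alpha> has_sum (1 - sum (m \<alpha>) F)) (UNIV - F)" if "0 < \<alpha>" "\<alpha> < 1" for \<alpha>
    using that by (intro has_sum_Diff total has_sum_finite) (auto simp: F_def)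
  have head: "sum (m \<alpha>) F \<le> (1 + 2 * \<alpha> / f1) / (1 + \<alpha>)\<^sup>2" if \<alpha>: "0 < \<alpha>" "\<alpha> < 1" for \<alpha>
  proof -
    define c where "c = f1 + \<alpha> * f2"
    have c: "c \<ge> f1" "c \<ge> 1" using f \<alpha> by (auto simp: c_def add_increasing2)
    have n1: "num 1 > 0" using num by simp
    have "m \<alpha> (0,0) = 1 / (1 + \<alpha>)\<^sup>2"
      by (simp add: m_def neg_trinomial_mass_def R_trinomial_def shifted_fact_Suc power2_eq_square)
    moreover have "m \<alpha> (1,0) = (\<alpha> / c) / (1 + \<alpha>)\<^sup>2"
      using n1
      by (simp add: m_def neg_trinomial_mass_def R_trinomial_def R_fact_Suc shifted_fact_Suc
          power2_eq_square c_def numeral_2_eq_2)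
    moreover have "m \<alpha> (0,1) = (\<alpha> / (c * c)) / (1 + \<alpha>)\<^sup>2"
      using n1
      by (simp add: m_def neg_trinomial_mass_def R_trinomial_def R_fact_Suc shifted_fact_Suc
          power2_eq_square c_def numeral_2_eq_2 mult_ac)
    ultimately have "sum (m \<alpha>) F = (1 + \<alpha> / c + \<alpha> / (c * c)) / (1 + \<alpha>)\<^sup>2"
      by (simp add: F_def add_divide_distrib)
    also have "\<dots> \<le> (1 + \<alpha> / f1 + \<alpha> / f1) / (1 + \<alpha>)\<^sup>2"
    proof -
      \<comment> \<open>So \<open>(1,0)\<close> and \<open>(0,1)\<close> each contribute at most \<open>\<alpha> / f1\<close>, to be set against the term
        \<open>2 \<alpha>\<close> of \<open>(1 + \<alpha>)\<^sup>2\<close>.\<close>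
      have "f1 * 1 \<le> c * c"
        using c f by (intro mult_mono) auto
      then have "\<alpha> / c \<le> \<alpha> / f1" "\<alpha> / (c * c) \<le> \<alpha> / f1"
        using c f \<alpha> by (auto intro!: divide_left_mono mult_pos_pos)
      then show ?thesis
        by (intro divide_right_mono) auto
    qed
    also have "\<dots> = (1 + 2 * \<alpha> / f1) / (1 + \<alpha>)\<^sup>2"
      by simp
    finally show ?thesis .
  qed
  have tail: "1 - sum (m \<alpha>) F \<le> K * \<alpha>\<^sup>2" if \<alpha>: "0 < \<alpha>" "\<alpha> < 1/2" for \<alpha>
  proof -
    have K: "K * \<alpha>\<^sup>2 = (exp ((1/2) / (1 - f2 / f1)))\<^sup>2 * (\<alpha> / (1/2))\<^sup>2"
      by (simp add: K_def power2_eq_square)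
    have "1 - sum (m \<alpha>) F \<le> K * \<alpha>\<^sup>2 * (1 - sum (m (1/2)) F)"
    proof (rule has_sum_mono)
      show "(m \<alpha> has_sum (1 - sum (m \<alpha>) F)) (UNIV - F)"
        using rest \<alpha> by simp
      show "((\<lambda>x. K * \<alpha>\<^sup>2 * m (1/2) x) has_sum (K * \<alpha>\<^sup>2 * (1 - sum (m (1/2)) F))) (UNIV - F)"
        using rest[of "1/2"] by (intro has_sum_cmult_right) simp
    next
      fix x assume x: "x \<in> UNIV - F"
      obtain w1 w2 where w: "x = (w1, w2)" by fastforce
      have "w1 + w2 \<ge> 2"
      proof (rule ccontr)
        assume "\<not> w1 + w2 \<ge> 2"
        then have "(w1 = 0 \<and> w2 = 0) \<or> (w1 = 1 \<and> w2 = 0) \<or> (w1 = 0 \<and> w2 = 1)" by arith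
        then show False using x w by (auto simp: F_def)
      qed
      then show "m \<alpha> x \<le> K * \<alpha>\<^sup>2 * m (1/2) x"
        unfolding K m_def w prod.case
          by (intro neg_trinomial_family_mass_comparison[OF num f(1,2)]) (use \<alpha> in auto)
    qed
    also have "\<dots> \<le> K * \<alpha>\<^sup>2 * 1"
      using nonneg[of "1/2"] by (intro mult_left_mono) (auto simp: K_def intro!: sum_nonneg)
    finally show ?thesis by simp
  qed
  have key: "1 - 1 / f1 \<le> 2 * K * \<alpha>" if \<alpha>: "0 < \<alpha>" "\<alpha> < 1/2" for \<alpha>
  proof -
    have "1 \<le> (1 + 2 * \<alpha> / f1) / (1 + \<alpha>)\<^sup>2 + K * \<alpha>\<^sup>2"
      using head[of \<alpha>] tail[of \<alpha>] \<alpha> by simp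
    then have "1 * (1 + \<alpha>)\<^sup>2 \<le> ((1 + 2 * \<alpha> / f1) / (1 + \<alpha>)\<^sup>2 + K * \<alpha>\<^sup>2) * (1 + \<alpha>)\<^sup>2"
      by (intro mult_right_mono) auto
    also have "\<dots> = 1 + 2 * \<alpha> / f1 + K * \<alpha>\<^sup>2 * (1 + \<alpha>)\<^sup>2"
      using \<alpha> by (simp add: distrib_right[of _ "K * \<alpha>\<^sup>2"])
    also have "\<dots> \<le> 1 + 2 * \<alpha> / f1 + K * \<alpha>\<^sup>2 * 4"
    proof -
      have "(1 + \<alpha>)\<^sup>2 \<le> 2\<^sup>2" using \<alpha> by (intro power_mono) auto
      then show ?thesis by (intro add_left_mono mult_left_mono) (auto simp: K_def)
    qed
    finally have "1 + 2 * \<alpha> \<le> 1 + 2 * \<alpha> / f1 + K * \<alpha>\<^sup>2 * 4"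
      by (simp add: power2_sum) (smt (verit) zero_le_power2)
    then have "(2 * \<alpha>) * (1 - 1 / f1) \<le> (2 * \<alpha>) * (2 * K * \<alpha>)"
      by (simp add: algebra_simps power2_eq_square)
    then show ?thesis
      using \<alpha> by simp
  qed
  have "((\<lambda>\<alpha>. 2 * K * \<alpha>) \<longlongrightarrow> 0) (at_right 0)"
    by (auto intro!: tendsto_eq_intros)
  moreover have "eventually (\<lambda>\<alpha>::real. \<alpha> \<in> {0<..<1/2}) (at_right 0)"
    by (rule eventually_at_right_real) simp
  then have "eventually (\<lambda>\<alpha>. 1 - 1 / f1 \<le> 2 * K * \<alpha>) (at_right 0)"
    by eventually_elim (use key in auto)
  ultimately have "1 - 1 / f1 \<le> 0"
    by (rule tendsto_lowerbound) simp
  then show ?thesis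
    using f by (simp add: field_simps)
qed

lemma neg_trinomial_family_imp_f1_eq_1:
  assumes num: "\<forall>k\<ge>1. num k > 0" and fam: "neg_trinomial_family num f1 f2"
    and "f1 \<noteq> 0" "f2 \<noteq> 0"
  shows "f1 = 1" "f2 > 0"
proof -
  have f1: "f1 \<ge> 1"
    using neg_trinomial_family_f1_ge_1[OF num fam] assms by simp
  show f2: "f2 > 0"
    using neg_trinomial_family_f2_pos[OF num fam] assms f1 by simp
  show "f1 = 1"
  proof (rule ccontr)
    assume "f1 \<noteq> 1"
    with f1 have "f1 > 1" by simp
    moreover have "f2 \<le> 1"
      using neg_trinomial_family_f2_le_1[OF num fam \<open>f1 > 1\<close> f2] .
    ultimately have "f1 \<le> 1"
      using neg_trinomial_family_f1_le_1[OF num fam f2] by simp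
    with \<open>f1 > 1\<close> show False by simp
  qed
qed

section \<open>Weighted masses as masses of a larger parameter\<close>

text \<open>The weight \<open>b powi (1 - (w1 + 1))\<close> is \<open>b\<^bsup>-w1\<^esup>\<close>, which is the quotient of the powers of \<open>b\<close>
  belonging to \<open>w1\<close> and \<open>w1 + 1\<close>. The first shifted factorial has the same length \<open>n + 1 + w1 + w2\<close>
  on both sides; the second has length \<open>n + w2\<close> on the left and \<open>n + 1 + w2\<close> on the right, and the
  inverse in front is its missing factor.\<close>

lemma mass_absorb1:
  assumes num: "\<forall>k\<ge>1. num k > 0" and "b > 0" "n \<ge> 1" "\<alpha>1 > 0" "\<alpha>2 > 0"
  shows "inverse (1 + \<alpha>2 * b ^ (n + w2)) * (b powi (1 - int (Suc w1)) * num (Suc w1)) *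
      neg_trinomial_mass num 1 b n \<alpha>1 \<alpha>2 (Suc w1) w2 =
    num n * \<alpha>1 * neg_trinomial_mass num 1 b (Suc n) \<alpha>1 \<alpha>2 w1 w2"
proof -
  define S where "S = shifted_fact 1 b 1"
  define d where "d = 1 + \<alpha>2 * b ^ (n + w2)"
  have S: "S \<alpha>1 (n + Suc w1 + w2) > 0" "S \<alpha>2 (n + w2) > 0"
    unfolding S_def using shifted_fact_pos assms by auto
  have d: "d > 0" unfolding d_def using assms by (intro add_pos_pos) auto
  have S2: "S \<alpha>2 (Suc n + w2) = S \<alpha>2 (n + w2) * d"
    by (simp add: S_def d_def shifted_fact_Suc)
  have pw: "b powi (1 - int (Suc w1)) * b powi (binom2 (int (Suc w1)) + binom2 (int w2)) =
      b powi (binom2 (int w1) + binom2 (int w2))"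
    unfolding binom2_Suc using assms by (simp flip: power_int_add)
  have tri: "num (Suc w1) * R_trinomial num (n + w1 + w2) (Suc w1) w2 =
      num n * R_trinomial num (n + w1 + w2) w1 w2"
    using R_trinomial_absorb[of num, OF num \<open>n \<ge> 1\<close>] .
  have "inverse d * (b powi (1 - int (Suc w1)) * num (Suc w1)) *
      neg_trinomial_mass num 1 b n \<alpha>1 \<alpha>2 (Suc w1) w2 =
      (num (Suc w1) * R_trinomial num (n + w1 + w2) (Suc w1) w2) * \<alpha>1 * (\<alpha>1 ^ w1 * \<alpha>2 ^ w2) *
      (b powi (1 - int (Suc w1)) * b powi (binom2 (int (Suc w1)) + binom2 (int w2))) /
      (S \<alpha>1 (n + Suc w1 + w2) * (S \<alpha>2 (n + w2) * d))"
    using S d by (simp add: neg_trinomial_mass_def S_def[symmetric] divide_inverse mult_ac)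
  also have "\<dots> = num n * \<alpha>1 * neg_trinomial_mass num 1 b (Suc n) \<alpha>1 \<alpha>2 w1 w2"
    unfolding tri pw S2[symmetric] by (simp add: neg_trinomial_mass_def S_def[symmetric])
  finally show ?thesis unfolding d_def .
qed

text \<open>Lowering the second variable by one while raising \<open>n\<close> by one keeps the length of both
  shifted factorials, so no correcting factor appears here.\<close>

lemma mass_absorb2:
  assumes num: "\<forall>k\<ge>1. num k > 0" and "b > 0" "n \<ge> 1"
  shows "b powi (1 - int (Suc w2)) * num (Suc w2) *
      neg_trinomial_mass num 1 b n \<alpha>1 \<alpha>2 w1 (Suc w2) =
    num n * \<alpha>2 * neg_trinomial_mass num 1 b (Suc n) \<alpha>1 \<alpha>2 w1 w2"
proof -
  define S where "S = shifted_fact 1 b 1"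
  have pw: "b powi (1 - int (Suc w2)) * b powi (binom2 (int w1) + binom2 (int (Suc w2))) =
      b powi (binom2 (int w1) + binom2 (int w2))"
    unfolding binom2_Suc using assms by (simp flip: power_int_add)
  have tri: "num (Suc w2) * R_trinomial num (n + w1 + w2) w1 (Suc w2) =
      num n * R_trinomial num (n + w1 + w2) w1 w2"
    using R_trinomial_absorb[of num, OF num \<open>n \<ge> 1\<close>, of w2 w1]
    by (simp add: R_trinomial_commute[of num _ w1] add_ac)
  have "b powi (1 - int (Suc w2)) * num (Suc w2) *
      neg_trinomial_mass num 1 b n \<alpha>1 \<alpha>2 w1 (Suc w2) =
      (num (Suc w2) * R_trinomial num (n + w1 + w2) w1 (Suc w2)) * \<alpha>2 * (\<alpha>1 ^ w1 * \<alpha>2 ^ w2) *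
      (b powi (1 - int (Suc w2)) * b powi (binom2 (int w1) + binom2 (int (Suc w2)))) /
      (S \<alpha>1 (Suc n + w1 + w2) * S \<alpha>2 (Suc n + w2))"
    by (simp add: neg_trinomial_mass_def S_def[symmetric] mult_ac)
  also have "\<dots> = num n * \<alpha>2 * neg_trinomial_mass num 1 b (Suc n) \<alpha>1 \<alpha>2 w1 w2"
    unfolding tri pw by (simp add: neg_trinomial_mass_def S_def[symmetric])
  finally show ?thesis .
qed

section \<open>Moments\<close>

lemma has_bochner_integral_discrete:
  fixes X :: "'a \<Rightarrow> 'b::countable" and g :: "'b \<Rightarrow> real"
  assumes "prob_space M" and X: "X \<in> measurable M (count_space UNIV)"
    and sum: "((\<lambda>x. measure M {\<omega> \<in> space M. X \<omega> = x} * g x) has_sum s) UNIV"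
  shows "has_bochner_integral M (\<lambda>\<omega>. g (X \<omega>)) s"
proof -
  interpret prob_space M by fact
  define m where "m = (\<lambda>x. measure M {\<omega> \<in> space M. X \<omega> = x})"
  have distr: "distr M (count_space UNIV) X = density (count_space UNIV) (\<lambda>x. ennreal (m x))"
  proof (rule measure_eqI_countable[of _ UNIV])
    fix x :: 'b
    have "X -` {x} \<inter> space M = {\<omega> \<in> space M. X \<omega> = x}" by auto
    then have "emeasure (distr M (count_space UNIV) X) {x} = ennreal (m x)"
      using X by (simp add: emeasure_distr m_def emeasure_eq_measure)
    also have "\<dots> = emeasure (density (count_space UNIV) (\<lambda>x. ennreal (m x))) {x}"
      by (simp add: emeasure_density)
    finally show "emeasure (distr M (count_space UNIV) X) {x} = \<dots>" .
  qed auto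
  have abs: "Infinite_Set_Sum.abs_summable_on (\<lambda>x. m x * g x) UNIV"
    unfolding abs_summable_equivalent[symmetric] summable_on_iff_abs_summable_on_real[symmetric]
    using sum unfolding m_def by (rule has_sum_imp_summable)
  then have int: "has_bochner_integral (count_space UNIV) (\<lambda>x. m x *\<^sub>R g x) s"
    using infsetsum_infsum[OF abs] infsumI[OF sum]
    by (simp add: has_bochner_integral_iff abs_summable_on_def infsetsum_def m_def)
  have "has_bochner_integral (distr M (count_space UNIV) X) g s"
    unfolding distr by (rule has_bochner_integral_density[OF _ _ _ int]) (auto simp: m_def)
  then show ?thesis
    using X by (simp add: has_bochner_integral_iff integrable_distr_eq integral_distr)
qed

text \<open>The weights \<open>[w]\<close> vanish at \<open>w = 0\<close>, so that the sums for the moments run over the shifted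
  lattice, where the absorption rules apply.\<close>

lemma has_sum_shift_fst:
  fixes f :: "nat \<times> nat \<Rightarrow> real"
  assumes "\<And>w2. f (0, w2) = 0" "((\<lambda>(w1, w2). f (Suc w1, w2)) has_sum s) UNIV"
  shows "(f has_sum s) UNIV"
proof -
  define h :: "nat \<times> nat \<Rightarrow> nat \<times> nat" where "h = (\<lambda>(w1, w2). (Suc w1, w2))"
  have "(f has_sum s) (range h)"
    using assms(2) by (subst has_sum_reindex) (auto simp: inj_def h_def o_def case_prod_unfold)
  moreover have "f x = 0" if "x \<notin> range h" for x
  proof -
    obtain w1 w2 where x: "x = (w1, w2)" by fastforce
    have "w1 = 0"
      using that unfolding x h_def by (cases w1) force+
    then show ?thesis using assms(1) x by simp
  qed
  ultimately show ?thesis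
    by (subst has_sum_cong_neutral[where T = "range h" and g = f]) auto
qed

lemma has_sum_shift_snd:
  fixes f :: "nat \<times> nat \<Rightarrow> real"
  assumes "\<And>w1. f (w1, 0) = 0" "((\<lambda>(w1, w2). f (w1, Suc w2)) has_sum s) UNIV"
  shows "(f has_sum s) UNIV"
proof -
  have "((f \<circ> prod.swap) has_sum s) UNIV"
  proof (rule has_sum_shift_fst)
    have "(((\<lambda>(w1, w2). f (w1, Suc w2)) \<circ> prod.swap) has_sum s) UNIV"
      using assms(2) by (subst has_sum_reindex[symmetric]) auto
    then show "((\<lambda>(w1, w2). (f \<circ> prod.swap) (Suc w1, w2)) has_sum s) UNIV"
      by (simp add: o_def case_prod_unfold)
  qed (use assms in auto)
  then have "(f has_sum s) (range prod.swap)"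
    by (subst has_sum_reindex) auto
  then show ?thesis by simp
qed

lemma deformationD:
  assumes "deformation R \<phi>1 \<phi>2 p q"
  shows "\<forall>n\<ge>1. R_number R p q n > 0" "R_number R p q 0 = 0" "\<phi>1 p q \<noteq> 0" "\<phi>2 p q \<noteq> 0"
    "R_number R (1 / p) (1 / q) n = (\<phi>1 p q * \<phi>2 p q) powi (1 - int n) * R_number R p q n"
proof -
  note def = assms[unfolded deformation_def]
  show "\<forall>n\<ge>1. R_number R p q n > 0"
    using def by metis
  have "\<forall>n. R_number R p q n = (\<phi>1 p q ^ n - \<phi>2 p q ^ n) / (\<phi>1 p q - \<phi>2 p q)"
    using def by (elim conjE)
  then show "R_number R p q 0 = 0"
    by simp
  show "\<phi>1 p q \<noteq> 0"
    using def by (elim conjE)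
  show "\<phi>2 p q \<noteq> 0"
    using def by (elim conjE)
  have "\<forall>n. R (1 / p) (1 / q) (of_real ((1 / p) ^ n), of_real ((1 / q) ^ n)) =
      of_real ((\<phi>1 p q * \<phi>2 p q) powi (1 - int n) * R_number R p q n)"
    using def by (elim conjE)
  then show "R_number R (1 / p) (1 / q) n = (\<phi>1 p q * \<phi>2 p q) powi (1 - int n) * R_number R p q n"
    unfolding R_number_def[of R "1 / p"] by (simp only: Re_complex_of_real)
qed

theorem corollary2p8:
  fixes R :: deform and \<phi>1 \<phi>2 :: "real \<Rightarrow> real \<Rightarrow> real"
    and p q \<alpha>1 \<alpha>2 :: real and n :: nat
    and M :: "'a measure" and W1 W2 :: "'a \<Rightarrow> nat"
  assumes "0 < q" "q < p" "p < 1"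
    and "deformation R \<phi>1 \<phi>2 p q"
    and "neg_trinomial_family (R_number R p q) (\<phi>1 p q) (\<phi>2 p q)"
    and "n \<ge> 1" "0 < \<alpha>1" "\<alpha>1 < 1" "0 < \<alpha>2" "\<alpha>2 < 1"
    and "neg_trinomial_distributed M W1 W2 (R_number R p q) (\<phi>1 p q) (\<phi>2 p q) n \<alpha>1 \<alpha>2"
  shows "integrable M (W_hat R \<phi>1 \<phi>2 p q n \<alpha>2 W1 W2) \<and>
         integrable M (W_bar R p q W2) \<and>
         integrable M (\<lambda>\<omega>. W_hat R \<phi>1 \<phi>2 p q n \<alpha>2 W1 W2 \<omega> * W_bar R p q W2 \<omega>) \<and>
         covariance M (W_hat R \<phi>1 \<phi>2 p q n \<alpha>2 W1 W2) (W_bar R p q W2) =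
           R_number R p q n * \<alpha>1 * \<alpha>2 * (R_number R p q (n + 1) - R_number R p q n)"
proof -
  note def = deformationD[OF assms(4)]
  define num where "num = R_number R p q"
  define b where "b = \<phi>2 p q"
  define inv_num where "inv_num = (\<lambda>k. b powi (1 - int k) * num k)"
  have num: "\<forall>k\<ge>1. num k > 0" and num0: "num 0 = 0"
    using def(1,2) by (auto simp: num_def)
  have \<phi>1: "\<phi>1 p q = 1" and b: "b > 0"
    using neg_trinomial_family_imp_f1_eq_1[OF def(1) assms(5) def(3,4)] by (auto simp: b_def)
  define m where "m = (\<lambda>n. neg_trinomial_mass num 1 b n \<alpha>1 \<alpha>2)"
  \<comment> \<open>Since \<open>\<phi>\<^sub>1 = 1\<close>, the powers of \<open>\<phi>\<^sub>1\<close> in the prefactor of \<open>[W\<^sub>1]\<close> disappear.\<close>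
  define hat where "hat = (\<lambda>w1 w2. inverse (1 + \<alpha>2 * b ^ (n + w2)) * inv_num w1)"
  have R_inv: "R_number R (1 / p) (1 / q) k = inv_num k" for k
    using def(5)[of k] by (simp add: inv_num_def num_def \<phi>1 b_def)
  have W_hat: "W_hat R \<phi>1 \<phi>2 p q n \<alpha>2 W1 W2 = (\<lambda>\<omega>. hat (W1 \<omega>) (W2 \<omega>))"
    by (simp add: W_hat_def fun_eq_iff hat_def R_inv \<phi>1 b_def)
  have W_bar: "W_bar R p q W2 = (\<lambda>\<omega>. inv_num (W2 \<omega>))"
    by (simp add: W_bar_def fun_eq_iff R_inv)
  have total: "((\<lambda>(w1, w2). m k w1 w2) has_sum 1) UNIV" if "k \<ge> 1" for k
    using neg_trinomial_familyD(2)[OF assms(5) that assms(7-10)] by (simp add: m_def num_def b_def \<phi>1)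
  have scaled: "((\<lambda>(w1, w2). c * m k w1 w2) has_sum c) UNIV" if "k \<ge> 1" for k c
    using has_sum_cmult_right[OF total[OF that], of c] by (simp add: case_prod_unfold)
  have abs1: "hat (Suc w1) w2 * m n (Suc w1) w2 = num n * \<alpha>1 * m (Suc n) w1 w2" for w1 w2
    using mass_absorb1[OF num b \<open>n \<ge> 1\<close> \<open>0 < \<alpha>1\<close> \<open>0 < \<alpha>2\<close>]
    unfolding m_def hat_def inv_num_def .
  have abs2: "inv_num (Suc w2) * m k w1 (Suc w2) = num k * \<alpha>2 * m (Suc k) w1 w2"
    if "k \<ge> 1" for k w1 w2
    using mass_absorb2[OF num b that] unfolding m_def inv_num_def .
  have zero: "inv_num 0 = 0" "hat 0 w2 = 0" for w2
    by (simp_all add: inv_num_def num0 hat_def)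
  define X where "X = (\<lambda>\<omega>. (W1 \<omega>, W2 \<omega>))"
  note dist = assms(11)[unfolded neg_trinomial_distributed_def]
  have X: "X \<in> measurable M (count_space UNIV)"
  proof -
    have "X \<in> measurable M (count_space UNIV \<Otimes>\<^sub>M count_space UNIV)"
      unfolding X_def using dist by (intro measurable_Pair) auto
    then show ?thesis by (simp add: pair_measure_countable)
  qed
  have law: "measure M {\<omega> \<in> space M. X \<omega> = x} = (case x of (w1, w2) \<Rightarrow> m n w1 w2)" for x
    using dist by (cases x) (simp add: X_def m_def num_def b_def \<phi>1)
  have expectation: "has_bochner_integral M (\<lambda>\<omega>. g (W1 \<omega>) (W2 \<omega>)) s"
    if "((\<lambda>(w1, w2). g w1 w2 * m n w1 w2) has_sum s) UNIV" for g s
    using has_bochner_integral_discrete[of M X "\<lambda>(w1, w2). g w1 w2" s] dist X that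
    unfolding law by (simp add: X_def case_prod_unfold mult.commute)
  have E_hat: "has_bochner_integral M (\<lambda>\<omega>. hat (W1 \<omega>) (W2 \<omega>)) (num n * \<alpha>1)"
    by (rule expectation[of hat, OF has_sum_shift_fst]) (use scaled in \<open>simp_all add: zero abs1\<close>)
  have E_bar: "has_bochner_integral M (\<lambda>\<omega>. inv_num (W2 \<omega>)) (num n * \<alpha>2)"
    by (rule expectation[of "\<lambda>_. inv_num", OF has_sum_shift_snd])
       (use scaled \<open>n \<ge> 1\<close> in \<open>simp_all add: zero abs2\<close>)
  have E_prod: "has_bochner_integral M (\<lambda>\<omega>. hat (W1 \<omega>) (W2 \<omega>) * inv_num (W2 \<omega>))
      (num n * \<alpha>1 * (num (Suc n) * \<alpha>2))"
  proof (rule expectation[of "\<lambda>w1 w2. hat w1 w2 * inv_num w2", OF has_sum_shift_fst])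
    have eq: "hat (Suc w1) w2 * inv_num w2 * m n (Suc w1) w2 =
        num n * \<alpha>1 * (inv_num w2 * m (Suc n) w1 w2)" for w1 w2
      using abs1[of w1 w2] by (metis mult.assoc mult.commute)
    \<comment> \<open>Absorbing \<open>[w\<^sub>1]\<close> has raised \<open>n\<close> to \<open>n + 1\<close>, so absorbing \<open>[w\<^sub>2]\<close> now yields \<open>[n + 1]\<close> and
      not \<open>[n]\<close>; hence the factor \<open>[n + 1] - [n]\<close> of the covariance.\<close>
    have "((\<lambda>(w1, w2). num n * \<alpha>1 * (inv_num w2 * m (Suc n) w1 w2)) has_sum
        (num n * \<alpha>1 * (num (Suc n) * \<alpha>2))) UNIV"
      by (rule has_sum_shift_snd)
         (use scaled[of "Suc (Suc n)" "num n * \<alpha>1 * (num (Suc n) * \<alpha>2)"] in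
           \<open>simp_all add: zero abs2 mult.assoc\<close>)
    then show "((\<lambda>(w1, w2). (case (Suc w1, w2) of (w1, w2) \<Rightarrow>
        hat w1 w2 * inv_num w2 * m n w1 w2)) has_sum (num n * \<alpha>1 * (num (Suc n) * \<alpha>2))) UNIV"
      by (simp add: eq)
  qed (simp add: zero)
  show ?thesis
    using E_hat E_bar E_prod unfolding W_hat W_bar covariance_def num_def[symmetric]
    by (simp add: has_bochner_integral_iff algebra_simps)
qed

end
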